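(* Let $\beta\ge 1/2$, let $f\in\mathcal{A}$, and let $$\mathcal{G}(z)=1-\frac{zf'(z)}{f(z)}+\frac{zf''(z)}{f'(z)},\quad z\in\mathbb{D}.$$ If $$\left(1+\beta\,\mathcal{G}(z)\right)\frac{zf'(z)}{f(z)}\prec 1+z,$$ then $f\in\mathcal{S}^*_{Ne}$.
   Context: $\mathbb{D}=\{z\in\mathbb{C}:|z|<1\}$. $\mathcal{A}$ is the class of analytic functions $f$ on $\mathbb{D}$ with $f(0)=0$ and $f'(0)=1$. For $f$ analytic on $\mathbb{D}$ and $g$ univalent (analytic and injective) on $\mathbb{D}$, $f\prec g$ means $f(0)=g(0)$ and $f(\mathbb{D})\subset g(\mathbb{D})$. $\mathcal{S}^*_{Ne}$ is the class of all $f\in\mathcal{A}$ with $\frac{zf'(z)}{f(z)}\prec\varphi_{Ne}(z)$, where $\varphi_{Ne}(z)=1+z-z^3/3$ (univalent on $\mathbb{D}$). The function on the left of a subordination is understood to be analytic on $\mathbb{D}$ (removable singularities being filled in; e.g. $zf'(z)/f(z)$ takes the value $1$ at $z=0$). *)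

theory Defs
  imports "HOL-Complex_Analysis.Complex_Analysis"
begin

definition class_A :: "(complex \<Rightarrow> complex) set" where
  "class_A = {f. f holomorphic_on ball 0 1 \<and> f 0 = 0 \<and> deriv f 0 = 1}"

definition univalent :: "(complex \<Rightarrow> complex) \<Rightarrow> bool" where
  "univalent g \<longleftrightarrow> g holomorphic_on ball 0 1 \<and> inj_on g (ball 0 1)"

definition subordinate :: "(complex \<Rightarrow> complex) \<Rightarrow> (complex \<Rightarrow> complex) \<Rightarrow> bool"
    (infix \<open>\<prec>\<^sub>s\<close> 50) where
  "f \<prec>\<^sub>s g \<longleftrightarrow> f holomorphic_on ball 0 1 \<and> univalent g \<and>
     f 0 = g 0 \<and> f ` ball 0 1 \<subseteq> g ` ball 0 1"

definition phi_Ne :: "complex \<Rightarrow> complex" where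
  "phi_Ne z = 1 + z - z ^ 3 / 3"

text \<open>
  The quotient \<open>z * deriv f z / f z\<close> is read with its removable singularities filled in
  (value 1 at the origin for \<open>f\<close> in \<^const>\<open>class_A\<close>), whereas division by zero in HOL
  would give 0 there; hence \<^const>\<open>remove_sings\<close>.  At a pole \<^const>\<open>remove_sings\<close> returns 0, so
  the holomorphy conjunct of \<^const>\<open>subordinate\<close> fails and poles in the disc are excluded.
\<close>

definition class_S_Ne :: "(complex \<Rightarrow> complex) set" where
  "class_S_Ne = {f \<in> class_A. remove_sings (\<lambda>z. z * deriv f z / f z) \<prec>\<^sub>s phi_Ne}"

definition G_op :: "(complex \<Rightarrow> complex) \<Rightarrow> complex \<Rightarrow> complex" where
  "G_op f z = 1 - z * deriv f z / f z + z * deriv (deriv f) z / deriv f z"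

end

theory Submission
  imports Defs
begin

text \<open>
  Put \<open>p z = z f'(z) / f(z)\<close>. Logarithmic differentiation gives \<open>z p'(z) / p(z) = \<G>(z)\<close>, so the
  hypothesis is the first-order linear condition \<open>p + \<beta> z p' \<prec> 1 + z\<close>. By the Schwarz lemma
  \<open>q = p - 1\<close> satisfies \<open>\<bar>q(z) + \<beta> z q'(z)\<bar> \<le> \<bar>z\<bar>\<close>. Along a ray this bounds the derivative of
  \<open>t\<^bsup>1/\<beta>\<^esup> q(t z)\<close>, and integrating yields \<open>\<bar>q(z)\<bar> \<le> \<bar>z\<bar> / (1 + \<beta>) \<le> 2/3 \<bar>z\<bar>\<close> (lemma
  \<open>norm_le_of_first_order_bound\<close>). On the unit circle \<open>\<bar>z - z\<^sup>3/3\<bar> \<ge> 2/3\<close>, and in fact \<open>phi_Ne\<close>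
  maps the unit disc onto a set containing the disc of radius \<open>2/3\<close> about \<open>1\<close> (lemma
  \<open>ball_subset_image_phi_Ne\<close>), whence \<open>p \<prec> phi_Ne\<close>.

  The argument needs \<open>p\<close> to be holomorphic on the whole disc, that is, \<open>f\<close> must have no zero other
  than the origin. At such a zero \<open>a \<noteq> 0\<close> of order \<open>n\<close>, \<open>p\<close> would have a simple pole with residue
  \<open>n a\<close>, and \<open>p + \<beta> z p'\<close> would have a pole of order two there, its leading coefficient
  \<open>- \<beta> n a\<^sup>2\<close> being nonzero. This contradicts the holomorphy of the left-hand side of the hypothesis
  (lemma \<open>no_zero_of_holomorphic_expression\<close>).
\<close>

section \<open>The image of the unit disc under \<open>phi_Ne\<close>\<close>

text \<open>
  The difference quotient of \<open>phi_Ne\<close> is \<open>1 - (z\<^sup>2 + z w + w\<^sup>2) / 3\<close>, and the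
  quadratic form has modulus less than 3 on the unit disc.
\<close>
lemma univalent_phi_Ne: "univalent phi_Ne"
  unfolding univalent_def
proof
  show "phi_Ne holomorphic_on ball 0 1"
    unfolding phi_Ne_def by (intro holomorphic_intros) auto
  show "inj_on phi_Ne (ball 0 1)"
  proof (rule inj_onI)
    fix z w :: complex
    assume z: "z \<in> ball 0 1" and w: "w \<in> ball 0 1" and eq: "phi_Ne z = phi_Ne w"
    have "a * b < 1" if "0 \<le> a" "a < 1" "0 \<le> b" "b < 1" for a b :: real
      using mult_strict_mono'[of a 1 b 1] that by simp
    then have "cmod (z^2) < 1" "cmod (w^2) < 1" "cmod (z * w) < 1"
      using z w by (simp_all add: power2_eq_square norm_mult)
    then have "cmod (z^2 + z * w + w^2) < 3"
      using norm_triangle_ineq[of "z^2 + z * w" "w^2"] norm_triangle_ineq[of "z^2" "z * w"]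
      by linarith
    then have "z^2 + z * w + w^2 \<noteq> 3" by auto
    moreover have "(z - w) * (3 - (z^2 + z * w + w^2)) = 3 * (phi_Ne z - phi_Ne w)"
      by (simp add: phi_Ne_def field_simps power2_eq_square power3_eq_cube)
    ultimately show "z = w" using eq by auto
  qed
qed

text \<open>
  A solution of \<open>phi_Ne z = 1 + c\<close> is a fixed point of \<open>z \<mapsto> c + z\<^sup>3/3\<close>, which maps the closed
  unit disc into the open one as soon as \<open>\<bar>c\<bar> < 2/3\<close>; Brouwer's theorem provides it.
\<close>
lemma ball_subset_image_phi_Ne: "ball 1 (2/3) \<subseteq> phi_Ne ` ball 0 1"
proof
  fix u :: complex
  assume "u \<in> ball 1 (2/3)"
  then have c: "cmod (u - 1) < 2/3" by (simp add: dist_norm norm_minus_commute)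
  have into: "cmod (u - 1 + z^3/3) < 1" if "cmod z \<le> 1" for z
  proof -
    have "cmod (z^3/3) \<le> 1/3"
      using that by (simp add: norm_divide norm_power power_le_one)
    then show ?thesis
      using c norm_triangle_ineq[of "u - 1" "z^3/3"] by linarith
  qed
  obtain z where z: "z \<in> cball 0 1" "u - 1 + z^3/3 = z"
  proof (rule brouwer[of "cball 0 1 :: complex set" "\<lambda>z. u - 1 + z^3/3"])
    show "continuous_on (cball 0 1) (\<lambda>z. u - 1 + z^3/3)"
      by (intro continuous_intros) auto
    show "(\<lambda>z. u - 1 + z^3/3) \<in> cball 0 1 \<rightarrow> cball 0 1"
      using less_imp_le[OF into] by auto
  qed auto
  have "cmod z < 1" using into[of z] z by simp
  moreover have "phi_Ne z = u"
  proof -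
    have "z - z^3/3 = u - 1" using z(2) by (metis add_diff_cancel_right')
    then show ?thesis by (simp add: phi_Ne_def add_diff_eq[symmetric])
  qed
  ultimately show "u \<in> phi_Ne ` ball 0 1" by force
qed

section \<open>A bound for a first-order differential expression\<close>

text \<open>
  With \<open>c = 1/\<beta>\<close>, the derivative of \<open>t\<^bsup>c\<^esup> q(t z)\<close> is
  \<open>c t\<^bsup>c-1\<^esup> (q + \<beta> w q')\<close> at \<open>w = t z\<close>, so its modulus is at most \<open>c t\<^bsup>c\<^esup> \<bar>z\<bar>\<close>.
  Integration over \<open>[0,1]\<close> gives \<open>c/(c+1) = 1/(1+\<beta>)\<close>.
\<close>
lemma norm_le_of_first_order_bound:
  fixes q :: "complex \<Rightarrow> complex" and \<beta> :: real
  assumes q: "q holomorphic_on ball 0 1" and \<beta>: "\<beta> > 0"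
    and bound: "\<And>z. z \<in> ball 0 1 \<Longrightarrow> cmod (q z + of_real \<beta> * z * deriv q z) \<le> cmod z"
    and z: "z \<in> ball 0 1"
  shows "cmod (q z) \<le> cmod z / (1 + \<beta>)"
proof -
  define c where "c = 1 / \<beta>"
  have c: "c > 0" "c * \<beta> = 1" using \<beta> by (auto simp: c_def)
  define F where "F = (\<lambda>t::real. of_real (t powr c) * q (of_real t * z))"
  define \<phi> where "\<phi> = (\<lambda>t::real. c / (c + 1) * t powr (c + 1) * cmod z)"
  define F' where "F' = (\<lambda>t::real. of_real (t powr c) * (z * deriv q (of_real t * z))
      + of_real (c * t powr (c - 1)) * q (of_real t * z))"
  have mem: "of_real t * z \<in> ball 0 1" if "0 \<le> t" "t \<le> 1" for t
    using that z mult_left_le_one_le[of "cmod z" t] by (simp add: norm_mult)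
  have "norm (F 1 - F 0) \<le> \<phi> 1 - \<phi> 0"
  proof (rule differentiable_bound_general[where f' = F' and \<phi>' = "\<lambda>t. c * t powr c * cmod z"])
    show "continuous_on {0..1} F"
      unfolding F_def
    proof (intro continuous_on_mult continuous_on_of_real)
      show "continuous_on {0..1::real} (\<lambda>t. t powr c)"
        using c by (intro continuous_on_powr') (auto intro!: continuous_intros)
      have "continuous_on {0..1::real} (q \<circ> (\<lambda>t. of_real t * z))"
        using mem by (intro continuous_on_compose continuous_intros
            continuous_on_subset[OF holomorphic_on_imp_continuous_on[OF q]]) auto
      then show "continuous_on {0..1::real} (\<lambda>t. q (of_real t * z))" by (simp add: o_def)
    qed
    show "continuous_on {0..1} \<phi>"
      unfolding \<phi>_def using c
      by (intro continuous_on_mult continuous_on_const continuous_on_powr' continuous_on_id) auto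
  next
    fix t :: real assume t: "0 < t" "t < 1"
    have m: "of_real t * z \<in> ball 0 1" using mem t by simp
    have "((\<lambda>t. of_real t * z) has_vector_derivative z) (at t)"
      by (auto intro!: derivative_eq_intros simp: has_vector_derivative_def scaleR_conv_of_real)
    moreover have "(q has_field_derivative deriv q (of_real t * z)) (at (of_real t * z))"
      using q m by (simp add: holomorphic_derivI)
    ultimately have dq: "((\<lambda>t. q (of_real t * z)) has_vector_derivative z * deriv q (of_real t * z)) (at t)"
      using field_vector_diff_chain_at[of "\<lambda>t. of_real t * z" z t q] by (simp add: o_def)
    have "((\<lambda>t. t powr c) has_field_derivative c * t powr (c - 1)) (at t)"
      using t(1) by (rule has_real_derivative_powr)
    then have "((\<lambda>t. complex_of_real (t powr c)) has_vector_derivative of_real (c * t powr (c - 1))) (at t)"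
      by (rule has_vector_derivative_of_real)
    from has_vector_derivative_mult[OF this dq]
    show "(F has_vector_derivative F' t) (at t)" by (simp add: F_def F'_def)
    have "((\<lambda>t. t powr (c + 1)) has_real_derivative (c + 1) * t powr c) (at t)"
      using has_real_derivative_powr[OF t(1), of "c + 1"] by simp
    then have "(\<phi> has_real_derivative c / (c + 1) * ((c + 1) * t powr c) * cmod z) (at t)"
      unfolding \<phi>_def by (intro DERIV_cmult DERIV_cmult_right)
    then show "(\<phi> has_vector_derivative c * t powr c * cmod z) (at t)"
      using c by (simp add: has_real_derivative_iff_has_vector_derivative)
    have tp: "t powr c = t powr (c - 1) * t" using t by (simp add: powr_diff)
    have "F' t = of_real (c * t powr (c - 1)) *
        (q (of_real t * z) + of_real \<beta> * (of_real t * z) * deriv q (of_real t * z))"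
      unfolding F'_def tp using c(2)
      by (simp add: algebra_simps flip: of_real_mult)
    then have "norm (F' t) \<le> c * t powr (c - 1) * (t * cmod z)"
      using bound[OF m] c t by (simp add: norm_mult mult_left_mono)
    then show "norm (F' t) \<le> c * t powr c * cmod z" by (simp add: tp mult_ac)
  qed auto
  then have "cmod (q z) \<le> c / (c + 1) * cmod z"
    using c by (simp add: F_def \<phi>_def)
  also have "c / (c + 1) = 1 / (1 + \<beta>)" using \<beta> by (simp add: c_def field_simps)
  finally show ?thesis by simp
qed

section \<open>The differential expression in terms of \<open>z f'/f\<close>\<close>

definition starlike_expr :: "real \<Rightarrow> (complex \<Rightarrow> complex) \<Rightarrow> complex \<Rightarrow> complex" where
  "starlike_expr \<beta> f z = (1 + of_real \<beta> * G_op f z) * (z * deriv f z / f z)"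

text \<open>
  At a zero of \<open>f'\<close> the identity can fail, since there division by zero gives \<open>starlike_expr\<close> the value 0.
\<close>
lemma starlike_expr_eq_first_order:
  assumes S: "open S" "z \<in> S" and f: "f holomorphic_on S"
    and f0: "\<And>w. w \<in> S \<Longrightarrow> f w \<noteq> 0" and P: "\<And>w. w \<in> S \<Longrightarrow> P w = w * deriv f w / f w"
    and f'0: "deriv f z \<noteq> 0"
  shows "starlike_expr \<beta> f z = P z + of_real \<beta> * z * deriv P z"
proof -
  have d1: "(f has_field_derivative deriv f z) (at z)"
    using f S by (rule holomorphic_derivI)
  have d2: "(deriv f has_field_derivative deriv (deriv f) z) (at z)"
    using holomorphic_deriv[OF f S(1)] S by (rule holomorphic_derivI)
  have "((\<lambda>w. w * deriv f w / f w) has_field_derivative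
      ((deriv f z + z * deriv (deriv f) z) * f z - z * deriv f z * deriv f z) / (f z * f z)) (at z)"
    using f0[OF S(2)] by (auto intro!: derivative_eq_intros d1 d2 simp: algebra_simps)
  then have "(P has_field_derivative
      ((deriv f z + z * deriv (deriv f) z) * f z - z * deriv f z * deriv f z) / (f z * f z)) (at z)"
    by (rule has_field_derivative_transform_within_open) (use S P in auto)
  then have dP: "deriv P z = ((deriv f z + z * deriv (deriv f) z) * f z - z * deriv f z * deriv f z) / (f z * f z)"
    by (rule DERIV_imp_deriv)
  show ?thesis
    unfolding dP P[OF S(2)] starlike_expr_def G_op_def using f0[OF S(2)] f'0 by (simp add: field_simps)
qed

text \<open>
  Filling in singularities extends the previous identity to the zeros of \<open>f'\<close>, where \<open>\<G>\<close> has a pole,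
  and to an isolated zero of \<open>f\<close> across which \<open>P\<close> is holomorphic (the origin).
\<close>
lemma remove_sings_starlike_expr_eq:
  assumes S: "open S" "z \<in> S" and f: "f holomorphic_on S" and holP: "P holomorphic_on S"
    and f0: "\<And>w. w \<in> S - {z} \<Longrightarrow> f w \<noteq> 0"
    and P: "\<And>w. w \<in> S - {z} \<Longrightarrow> P w = w * deriv f w / f w"
    and f'0: "\<forall>\<^sub>F w in at z. deriv f w \<noteq> 0"
  shows "remove_sings (starlike_expr \<beta> f) z = P z + of_real \<beta> * z * deriv P z"
proof (rule remove_sings_eqI)
  have "\<forall>\<^sub>F w in at z. w \<in> S - {z}" using S by (rule eventually_at_in_open)
  with f'0 have ev: "\<forall>\<^sub>F w in at z. P w + of_real \<beta> * w * deriv P w = starlike_expr \<beta> f w"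
  proof eventually_elim
    case (elim w)
    then show ?case
      using S f f0 P by (intro starlike_expr_eq_first_order[of "S - {z}", symmetric])
        (auto intro: holomorphic_on_subset)
  qed
  have "(\<lambda>w. P w + of_real \<beta> * w * deriv P w) holomorphic_on S"
    using holP S by (intro holomorphic_intros)
  then have "isCont (\<lambda>w. P w + of_real \<beta> * w * deriv P w) z"
    using S holomorphic_on_imp_continuous_on continuous_on_eq_continuous_at by blast
  then show "starlike_expr \<beta> f \<midarrow>z\<rightarrow> P z + of_real \<beta> * z * deriv P z"
    using ev unfolding isCont_def by (rule Lim_transform_eventually)
qed

text \<open>
  Writing \<open>f = (w - a)\<^sup>n g\<close> near the zero, \<open>p = R / (w - a)\<close> with \<open>R = w (n + (w - a) g'/g)\<close>, so
  that \<open>(w - a)\<^sup>2 (p + \<beta> w p') = (w - a) R + \<beta> w ((w - a) R' - R)\<close> tends to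
  \<open>- \<beta> a R(a) = - \<beta> n a\<^sup>2\<close>; if the expression extended continuously to \<open>a\<close>, this limit would be 0.
\<close>
lemma no_zero_of_holomorphic_expression:
  assumes f: "f holomorphic_on ball 0 1" and f'0: "deriv f 0 = 1" and \<beta>: "\<beta> > 0"
    and H: "remove_sings (starlike_expr \<beta> f) holomorphic_on ball 0 1"
    and a: "a \<in> ball 0 1" "a \<noteq> 0"
  shows "f a \<noteq> 0"
proof
  assume fa: "f a = 0"
  have nc: "\<not> f constant_on ball 0 1"
  proof
    assume "f constant_on ball 0 1"
    then obtain k where "\<And>x. x \<in> ball 0 1 \<Longrightarrow> f x = k" unfolding constant_on_def by blast
    then have "(f has_field_derivative 0) (at 0)"
      by (intro has_field_derivative_transform_within_open[OF DERIV_const[of k], where S = "ball 0 1"]) auto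
    from DERIV_imp_deriv[OF this] show False using f'0 by simp
  qed
  obtain g r n where n: "0 < (n::nat)" and r: "0 < r" "ball a r \<subseteq> ball 0 1"
    and g: "g holomorphic_on ball a r"
    and fg: "\<And>w. w \<in> ball a r \<Longrightarrow> f w = (w - a)^n * g w"
    and g0: "\<And>w. w \<in> ball a r \<Longrightarrow> g w \<noteq> 0"
    by (rule holomorphic_factor_zero_nonconstant[OF f open_ball connected_ball a(1) fa nc]) iprover
  let ?S = "ball a r - {a}"
  define R where "R = (\<lambda>w. w * (of_nat n + (w - a) * (deriv g w / g w)))"
  define P where "P = (\<lambda>w. R w / (w - a))"
  have R: "R holomorphic_on ball a r"
    unfolding R_def using g g0 by (intro holomorphic_intros) auto
  have P: "P w = w * deriv f w / f w" if w: "w \<in> ?S" for w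
  proof -
    have "((\<lambda>w. (w - a)^n * g w) has_field_derivative
        of_nat n * (w - a)^(n - 1) * g w + (w - a)^n * deriv g w) (at w)"
      using w holomorphic_derivI[OF g open_ball, of w] by (auto intro!: derivative_eq_intros)
    then have "(f has_field_derivative
        of_nat n * (w - a)^(n - 1) * g w + (w - a)^n * deriv g w) (at w)"
      by (rule has_field_derivative_transform_within_open[of _ _ _ "ball a r"]) (use w fg in auto)
    then have "deriv f w = of_nat n * (w - a)^(n - 1) * g w + (w - a)^n * deriv g w"
      by (rule DERIV_imp_deriv)
    moreover have "(w - a)^n = (w - a) * (w - a)^(n - 1)" using n by (simp add: power_eq_if)
    ultimately show ?thesis
      using w g0[of w] fg[of w] by (simp add: P_def R_def divide_simps) (simp add: algebra_simps)
  qed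
  have fS: "f w \<noteq> 0" if "w \<in> ?S" for w using that fg[of w] g0[of w] by auto
  have ne': "\<forall>\<^sub>F w in at z. deriv f w \<noteq> 0" if "z \<in> ball 0 1" for z
    using non_zero_neighbour_alt[OF holomorphic_deriv[OF f open_ball] open_ball connected_ball that, of 0] f'0
    by (auto elim: eventually_mono)
  have clear_denominators: "d^2 * (x / d + b * (y / d^2)) = d * x + b * y" if "d \<noteq> 0" for b d x y :: complex
    using that by (simp add: field_simps power2_eq_square)
  have Heq: "(w - a)^2 * remove_sings (starlike_expr \<beta> f) w =
      (w - a) * R w + of_real \<beta> * w * ((w - a) * deriv R w - R w)" if w: "w \<in> ?S" for w
  proof -
    have holP: "P holomorphic_on ?S"
      unfolding P_def using R by (intro holomorphic_intros holomorphic_on_subset[OF R]) auto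
    have "remove_sings (starlike_expr \<beta> f) w = P w + of_real \<beta> * w * deriv P w"
      using w r fS P ne'[of w] holP
      by (intro remove_sings_starlike_expr_eq[of ?S]) (auto intro: holomorphic_on_subset[OF f])
    moreover have "deriv P w = (deriv R w * (w - a) - R w) / (w - a)^2"
      unfolding P_def using w holomorphic_derivI[OF R open_ball, of w]
      by (intro DERIV_imp_deriv) (auto intro!: derivative_eq_intros simp: power2_eq_square)
    ultimately show ?thesis
      using w clear_denominators[of "w - a"] by (simp add: P_def)
  qed
  define L where "L = (\<lambda>w. (w - a)^2 * remove_sings (starlike_expr \<beta> f) w -
      ((w - a) * R w + of_real \<beta> * w * ((w - a) * deriv R w - R w)))"
  have "L holomorphic_on ball a r"
    unfolding L_def using R by (intro holomorphic_intros holomorphic_on_subset[OF H r(2)]) auto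
  then have "isCont L a"
    using r(1) holomorphic_on_imp_continuous_on continuous_on_eq_continuous_at
    by (metis centre_in_ball open_ball)
  moreover have "\<forall>\<^sub>F w in at a. L w = 0"
  proof -
    have "\<forall>\<^sub>F w in at a. w \<in> ?S" using r by (intro eventually_at_in_open) auto
    then show ?thesis by eventually_elim (use Heq in \<open>simp add: L_def\<close>)
  qed
  ultimately have "L a = 0"
    unfolding isCont_def by (metis LIM_unique tendsto_eventually)
  then show False using \<beta> a n by (simp add: L_def R_def)
qed

theorem corollary3p2:
  fixes \<beta> :: real and f :: "complex \<Rightarrow> complex"
  assumes "\<beta> \<ge> 1 / 2"
    and "f \<in> class_A"
    and "remove_sings (\<lambda>z. (1 + of_real \<beta> * G_op f z) * (z * deriv f z / f z)) \<prec>\<^sub>s (\<lambda>z. 1 + z)"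
  shows "f \<in> class_S_Ne"
proof -
  define H where "H = remove_sings (starlike_expr \<beta> f)"
  have \<beta>: "\<beta> > 0" using assms(1) by simp
  have f: "f holomorphic_on ball 0 1" "f 0 = 0" "deriv f 0 = 1"
    using assms(2) by (auto simp: class_A_def)
  have "H \<prec>\<^sub>s (\<lambda>z. 1 + z)"
    using assms(3) unfolding H_def starlike_expr_def .
  then have holH: "H holomorphic_on ball 0 1" and H0: "H 0 = 1"
    and Hin: "\<And>z. z \<in> ball 0 1 \<Longrightarrow> H z \<in> (\<lambda>z. 1 + z) ` ball 0 1"
    unfolding subordinate_def by (simp, simp, blast)
  have f0: "f z \<noteq> 0" if "z \<in> ball 0 1" "z \<noteq> 0" for z
    using no_zero_of_holomorphic_expression[OF f(1,3) \<beta>] holH that unfolding H_def by blast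
  \<comment> \<open>\<open>p\<close> is written through \<open>k z = f z / z\<close>, as \<open>z f'/f = 1 + z k'/k\<close> is free of the singularity at 0.\<close>
  define k where "k = (\<lambda>z. if z = 0 then 1 else f z / z)"
  have k: "k holomorphic_on ball 0 1"
    by (rule pole_theorem_open_0[where g = f and a = 0]) (use f in \<open>auto simp: k_def\<close>)
  have fk: "f z = z * k z" for z using f(2) by (simp add: k_def)
  have k0: "k z \<noteq> 0" if "z \<in> ball 0 1" for z using f0[OF that] by (auto simp: k_def)
  define P where "P = (\<lambda>z. 1 + z * (deriv k z / k z))"
  have holP: "P holomorphic_on ball 0 1"
    unfolding P_def using k k0 by (intro holomorphic_intros) auto
  have P: "P z = z * deriv f z / f z" if z: "z \<in> ball 0 1 - {0}" for z
  proof -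
    have "((\<lambda>z. z * k z) has_field_derivative k z + z * deriv k z) (at z)"
      using z holomorphic_derivI[OF k open_ball, of z] by (auto intro!: derivative_eq_intros)
    then have "deriv f z = k z + z * deriv k z"
      by (metis (no_types, lifting) DERIV_imp_deriv fk ext)
    then show ?thesis using z k0[of z] by (simp add: P_def fk divide_simps)
  qed
  have ne': "\<forall>\<^sub>F w in at z. deriv f w \<noteq> 0" if "z \<in> ball 0 1" for z
    using non_zero_neighbour_alt[OF holomorphic_deriv[OF f(1) open_ball] open_ball connected_ball that, of 0] f(3)
    by (auto elim: eventually_mono)
  have HP: "H z = P z + of_real \<beta> * z * deriv P z" if z: "z \<in> ball 0 1" for z
    unfolding H_def
    \<comment> \<open>The origin, where \<open>f\<close> vanishes, is kept in the domain only when it is the point \<open>z\<close> itself.\<close>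
  proof (rule remove_sings_starlike_expr_eq[of "ball 0 1 - ({0} - {z})"])
    show "open (ball 0 1 - ({0} - {z}))" by (intro open_Diff finite_imp_closed) auto
    show "f holomorphic_on ball 0 1 - ({0} - {z})" "P holomorphic_on ball 0 1 - ({0} - {z})"
      using f(1) holP by (auto intro: holomorphic_on_subset)
  qed (use z f0 P ne' in auto)
  define q where "q = (\<lambda>z. P z - 1)"
  have q: "q holomorphic_on ball 0 1" unfolding q_def using holP by (intro holomorphic_intros)
  have "cmod (q z + of_real \<beta> * z * deriv q z) \<le> cmod z" if z: "z \<in> ball 0 1" for z
  proof -
    have "deriv q z = deriv P z"
      unfolding q_def using holomorphic_derivI[OF holP open_ball z]
      by (intro DERIV_imp_deriv) (auto intro!: derivative_eq_intros)
    then have "q z + of_real \<beta> * z * deriv q z = H z - 1" using HP[OF z] by (simp add: q_def)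
    moreover have "cmod (H z - 1) \<le> cmod z"
    proof (rule Schwarz_Lemma(1)[of "\<lambda>z. H z - 1"])
      show "cmod (H w - 1) < 1" if "cmod w < 1" for w
      proof -
        have "w \<in> ball 0 1" using that by simp
        from Hin[OF this] obtain v where "v \<in> ball 0 1" "H w = 1 + v" by blast
        then show ?thesis by simp
      qed
    qed (use holH H0 z in \<open>auto intro!: holomorphic_intros\<close>)
    ultimately show ?thesis by simp
  qed
  then have qle: "cmod (q z) \<le> cmod z / (1 + \<beta>)" if "z \<in> ball 0 1" for z
    using norm_le_of_first_order_bound[OF q \<beta> _ that] by blast
  have Pin: "P z \<in> ball 1 (2/3)" if z: "z \<in> ball 0 1" for z
  proof -
    have "cmod z / (1 + \<beta>) \<le> cmod z / (3/2)" using assms(1) by (intro divide_left_mono) auto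
    also have "\<dots> < 2/3" using z by simp
    finally have "cmod (q z) < 2/3" using qle[OF z] by linarith
    then show ?thesis by (simp add: q_def dist_norm norm_minus_commute)
  qed
  have rP: "remove_sings (\<lambda>z. z * deriv f z / f z) z = P z" if z: "z \<in> ball 0 1" for z
  proof (rule remove_sings_eqI)
    have "isCont P z"
      using z holP holomorphic_on_imp_continuous_on continuous_on_eq_continuous_at open_ball by blast
    moreover have "\<forall>\<^sub>F w in at z. P w = w * deriv f w / f w"
    proof -
      have "\<forall>\<^sub>F w in at z. w \<in> ball 0 1 - {0}"
        using non_zero_neighbour_alt[OF holomorphic_on_ident open_ball connected_ball z, of "1/2"]
        by (auto elim!: eventually_mono)
      then show ?thesis by eventually_elim (use P in auto)
    qed
    ultimately show "(\<lambda>z. z * deriv f z / f z) \<midarrow>z\<rightarrow> P z"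
      unfolding isCont_def by (rule Lim_transform_eventually)
  qed
  have "remove_sings (\<lambda>z. z * deriv f z / f z) \<prec>\<^sub>s phi_Ne"
    unfolding subordinate_def
  proof (intro conjI)
    show "remove_sings (\<lambda>z. z * deriv f z / f z) holomorphic_on ball 0 1"
      using holP by (rule holomorphic_transform) (simp add: rP)
    show "remove_sings (\<lambda>z. z * deriv f z / f z) 0 = phi_Ne 0"
      by (simp add: rP P_def phi_Ne_def)
    show "remove_sings (\<lambda>z. z * deriv f z / f z) ` ball 0 1 \<subseteq> phi_Ne ` ball 0 1"
      using Pin rP ball_subset_image_phi_Ne by (metis (no_types, lifting) image_subsetI subsetD)
  qed (rule univalent_phi_Ne)
  then show ?thesis using assms(2) by (simp add: class_S_Ne_def)
qed

end
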